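(* Let $(A,B,p,r,c)$ be a linear production situation with a common-pool resource (LPP situation) with producer set $N$ such that $M^{\min}=\varnothing$. Then the characteristic function form game $(N,v)$ associated with this situation, given by $v(\varnothing)=0$, $v(S)=\mathrm{value}(S;d_S)$ for every nonempty $S\subsetneq N$ and $v(N)=\mathrm{value}(N;\min\{d_N,r\})$, has a nonempty core.
   Context: LPP situation. $N=\{1,\dots,n\}$ is a set of producers, $G=\{1,\dots,g\}$ a set of goods, $Q=\{1,\dots,q\}$ a set of resources; in addition there is one external common-pool resource, of which a total amount $r\ge 0$ is available at unit cost $c\ge 0$. Producer $i$ owns $b^i\in\mathbb{R}_+^q$; $b^S=\sum_{i\in S}b^i$; $B$ is the $q\times n$ matrix with columns $b^i$, and for every $t\in Q$ there is a producer $i$ with $b^i_t>0$. $A$ is a nonnegative $(q+1)\times g$ matrix ($a_{tj}$ is the amount of resource $t$ needed per unit of good $j$; row $q+1$ refers to the common-pool resource), with $a_{(q+1)j}>0$ for all $j\in G$ and, for every $j\in G$, some $t\in Q$ with $a_{tj}>0$. $p\in\mathbb{R}_{++}^g$ is the price vector and $p_j>a_{(q+1)j}c$ for all $j\in G$. For a coalition $S\subseteq N$ and $z\ge 0$, $$\mathrm{value}(S;z)=\max\Big\{\sum_{j=1}^g p_jx_j-cz \;:\; Ax\le \begin{pmatrix} b^S\\ z\end{pmatrix},\ x\in\mathbb{R}^g_+\Big\}.$$ The optimal demand of $S$ is $d_S=\min\{z\ge 0:\ \mathrm{value}(S;z)=\max_{z'\ge 0}\mathrm{value}(S;z')\}$.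 It is assumed that for every nonempty $S$ there is $z$ with $\mathrm{value}(S;z)>0$ (so $d_S>0$). $\mathcal{P}(N)$ is the set of partitions of $N$ (into nonempty coalitions). $P'$ is a refinement of $P$, written $P'\subseteq P$, if each $S'\in P'$ is contained in some $S\in P$. For $P\in\mathcal{P}(N)$ put $d(P)=\sum_{S\in P}d_S$. Then $M^{\min}=\{P\in\mathcal{P}(N): d(P)>r$ and $P$ is minimal for $\subseteq\}$, where minimal means that no refinement $P'\neq P$ of $P$ satisfies $d(P')>r$. The core of a game $(N,v)$ is $C(v)=\{x\in\mathbb{R}^N: \sum_{i\in N}x_i=v(N),\ \sum_{i\in S}x_i\ge v(S)\ \forall S\subseteq N\}$. *)

theory Defs
  imports Complex_Main "HOL-Library.Disjoint_Sets" "HOL-Library.FuncSet"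
begin

(* Vectors and matrices are functions on indices starting at 1; only the entries within the
   dimensions stored in the record are used.  tech L t j is the entry of A in row t and column j,
   where row num_resources L + 1 belongs to the common-pool resource; endow L t i is the amount of
   resource t owned by producer i (row t, column i of B). *)

record lpp =
  num_producers :: nat
  num_goods :: nat
  num_resources :: nat
  tech :: "nat \<Rightarrow> nat \<Rightarrow> real"
  endow :: "nat \<Rightarrow> nat \<Rightarrow> real"
  price :: "nat \<Rightarrow> real"
  pool :: real
  unit_cost :: real

definition producers :: "lpp \<Rightarrow> nat set" where
  "producers L = {1..num_producers L}"

definition goods :: "lpp \<Rightarrow> nat set" where
  "goods L = {1..num_goods L}"

definition resources :: "lpp \<Rightarrow> nat set" where
  "resources L = {1..num_resources L}"

definition coalition_endow :: "lpp \<Rightarrow> nat set \<Rightarrow> nat \<Rightarrow> real" where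
  "coalition_endow L S t = (\<Sum>i\<in>S. endow L t i)"

definition feasible :: "lpp \<Rightarrow> nat set \<Rightarrow> real \<Rightarrow> (nat \<Rightarrow> real) \<Rightarrow> bool" where
  "feasible L S z x \<longleftrightarrow>
     (\<forall>t\<in>resources L. (\<Sum>j\<in>goods L. tech L t j * x j) \<le> coalition_endow L S t) \<and>
     (\<Sum>j\<in>goods L. tech L (num_resources L + 1) j * x j) \<le> z \<and>
     (\<forall>j\<in>goods L. 0 \<le> x j)"

(* Meant for z \<ge> 0 only.  In a situation satisfying the predicate lpp_situation below the maximum
   is then attained, since every good needs some owned resource, which bounds the plans; for
   negative z there is no feasible plan. *)
definition coalition_value :: "lpp \<Rightarrow> nat set \<Rightarrow> real \<Rightarrow> real" where
  "coalition_value L S z =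
     (GREATEST v. \<exists>x. feasible L S z x \<and>
        v = (\<Sum>j\<in>goods L. price L j * x j) - unit_cost L * z)"

definition optimal_demand :: "lpp \<Rightarrow> nat set \<Rightarrow> real" where
  "optimal_demand L S =
     (LEAST z. 0 \<le> z \<and> (\<forall>z'\<ge>0. coalition_value L S z' \<le> coalition_value L S z))"

definition lpp_situation :: "lpp \<Rightarrow> bool" where
  "lpp_situation L \<longleftrightarrow>
     1 \<le> num_producers L \<and> 1 \<le> num_goods L \<and> 1 \<le> num_resources L \<and>
     0 \<le> pool L \<and> 0 \<le> unit_cost L \<and>
     (\<forall>t\<in>resources L. \<forall>i\<in>producers L. 0 \<le> endow L t i) \<and>
     (\<forall>t\<in>resources L. \<exists>i\<in>producers L. 0 < endow L t i) \<and>
     (\<forall>t\<in>{1..num_resources L + 1}. \<forall>j\<in>goods L. 0 \<le> tech L t j) \<and>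
     (\<forall>j\<in>goods L. 0 < tech L (num_resources L + 1) j) \<and>
     (\<forall>j\<in>goods L. \<exists>t\<in>resources L. 0 < tech L t j) \<and>
     (\<forall>j\<in>goods L. 0 < price L j) \<and>
     (\<forall>j\<in>goods L. tech L (num_resources L + 1) j * unit_cost L < price L j) \<and>
     (\<forall>S. S \<subseteq> producers L \<and> S \<noteq> {} \<longrightarrow> (\<exists>z\<ge>0. 0 < coalition_value L S z))"

definition partition_demand :: "lpp \<Rightarrow> nat set set \<Rightarrow> real" where
  "partition_demand L P = (\<Sum>S\<in>P. optimal_demand L S)"

definition M_min :: "lpp \<Rightarrow> nat set set set" where
  "M_min L = {P. partition_on (producers L) P \<and> pool L < partition_demand L P \<and>
     \<not> (\<exists>P'. refines (producers L) P' P \<and> P' \<noteq> P \<and> pool L < partition_demand L P')}"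

(* Only the values on subsets of producers L are meaningful. *)
definition lpp_game :: "lpp \<Rightarrow> nat set \<Rightarrow> real" where
  "lpp_game L S =
     (if S = {} then 0
      else if S = producers L
        then coalition_value L S (min (optimal_demand L S) (pool L))
      else coalition_value L S (optimal_demand L S))"

definition core :: "'a set \<Rightarrow> ('a set \<Rightarrow> real) \<Rightarrow> ('a \<Rightarrow> real) set" where
  "core N v = {x \<in> N \<rightarrow>\<^sub>E UNIV. (\<Sum>i\<in>N. x i) = v N \<and> (\<forall>S\<subseteq>N. v S \<le> (\<Sum>i\<in>S. x i))}"

end

theory Submission
  imports Defs "HOL-Analysis.Function_Topology"
begin

text \<open>If no partition has total demand above the pool, then in particular \<open>d_N \<le> r\<close>, so the pool
constraint never binds and every coalition simply maximises the net price
\<open>p_j - c a_(q+1)j\<close> over its own resources. This is Owen's linear production game: optimal dual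
prices \<open>y\<close> of the grand coalition's program, obtained from Farkas' lemma, give the core
allocation \<open>x_i = \<Sum>\<^sub>t y_t b^i_t\<close>.\<close>

section \<open>Farkas' lemma\<close>

text \<open>Bartl's induction on the number of constraints: if the new constraint \<open>k\<close> is needed, a point \<open>z\<close>
violating only it allows one to project all functionals along \<open>z\<close> onto the kernel of \<open>k\<close>.\<close>

lemma farkas:
  fixes a :: "'i \<Rightarrow> 'j \<Rightarrow> real" and c :: "'j \<Rightarrow> real"
  assumes "finite I" "finite J"
    and "\<And>x. (\<And>i. i \<in> I \<Longrightarrow> (\<Sum>j\<in>J. a i j * x j) \<le> 0) \<Longrightarrow> (\<Sum>j\<in>J. c j * x j) \<le> 0"
  shows "\<exists>y. (\<forall>i\<in>I. 0 \<le> y i) \<and> (\<forall>j\<in>J. c j = (\<Sum>i\<in>I. y i * a i j))"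
  using assms(1,3)
proof (induction I arbitrary: a c rule: finite_induct)
  case empty
  \<comment> \<open>Without constraints every point is admissible; testing the functional at
    \<open>c\<close> itself makes its squared norm at most 0.\<close>
  have "(\<Sum>j\<in>J. c j * c j) = 0"
    using empty[of c] by (simp add: antisym sum_nonneg)
  then have "\<forall>j\<in>J. c j * c j = 0"
    using assms(2) by (subst (asm) sum_nonneg_eq_0_iff) auto
  then show ?case
    by simp
next
  case (insert k I)
  show ?case
  proof (cases "\<forall>x. (\<forall>i\<in>I. (\<Sum>j\<in>J. a i j * x j) \<le> 0) \<longrightarrow> (\<Sum>j\<in>J. c j * x j) \<le> 0")
    case True
    then obtain y where y: "\<forall>i\<in>I. 0 \<le> y i" "\<forall>j\<in>J. c j = (\<Sum>i\<in>I. y i * a i j)"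
      using insert.IH[of a c] by auto
    have "(\<Sum>i\<in>insert k I. (y(k := 0)) i * a i j) = (\<Sum>i\<in>I. y i * a i j)" for j
      using insert.hyps by (auto intro: sum.cong)
    with y show ?thesis
      by (intro exI[of _ "y(k := 0)"]) auto
  next
    case False
    then obtain w where w: "\<And>i. i \<in> I \<Longrightarrow> (\<Sum>j\<in>J. a i j * w j) \<le> 0" "0 < (\<Sum>j\<in>J. c j * w j)"
      by force
    have kw: "0 < (\<Sum>j\<in>J. a k j * w j)"
      using insert.prems[of w] w by force
    \<comment> \<open>The scaling gives \<open>z\<close> the value 1 under row \<open>k\<close>, so
      subtracting \<open>z\<close> times the row's value at \<open>x\<close> moves any
      \<open>x\<close> into the kernel of that row.\<close>
    define z where "z j = w j / (\<Sum>j\<in>J. a k j * w j)" for j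
    have dz: "(\<Sum>j\<in>J. f j * z j) = (\<Sum>j\<in>J. f j * w j) / (\<Sum>j\<in>J. a k j * w j)" for f
      by (simp add: z_def sum_divide_distrib)
    have kz: "(\<Sum>j\<in>J. a k j * z j) = 1"
      using kw by (simp add: dz)
    have iz: "(\<Sum>j\<in>J. a i j * z j) \<le> 0" if "i \<in> I" for i
      using w(1)[OF that] kw by (simp add: dz divide_le_0_iff)
    have cz: "0 < (\<Sum>j\<in>J. c j * z j)"
      using w(2) kw by (simp add: dz)
    \<comment> \<open>\<open>p\<close> is the adjoint of this projection of points: evaluating
      \<open>p f\<close> at \<open>x\<close> means evaluating \<open>f\<close> at the projected
      \<open>x\<close>, as \<open>proj\<close> records.\<close>
    define p where "p f j = f j - (\<Sum>j\<in>J. f j * z j) * a k j" for f j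
    have proj: "(\<Sum>j\<in>J. p f j * x j) = (\<Sum>j\<in>J. f j * (x j - (\<Sum>j\<in>J. a k j * x j) * z j))" for f x
    proof -
      have "(\<Sum>j\<in>J. f j * (x j - r * z j)) = (\<Sum>j\<in>J. f j * x j) - (\<Sum>j\<in>J. f j * z j) * r" for r
        by (simp add: right_diff_distrib sum_subtractf sum_distrib_left mult_ac)
      then show ?thesis
        by (simp add: p_def left_diff_distrib sum_subtractf mult.assoc flip: sum_distrib_left)
    qed
    have "\<exists>y. (\<forall>i\<in>I. 0 \<le> y i) \<and> (\<forall>j\<in>J. p c j = (\<Sum>i\<in>I. y i * p (a i) j))"
    proof (rule insert.IH)
      fix x assume x: "\<And>i. i \<in> I \<Longrightarrow> (\<Sum>j\<in>J. p (a i) j * x j) \<le> 0"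
      \<comment> \<open>\<open>p\<close> annihilates row \<open>k\<close>, so the projected point
        meets constraint \<open>k\<close> with equality and the premise for
        \<open>insert k I\<close> applies to it.\<close>
      have "(\<Sum>j\<in>J. a k j * (x j - (\<Sum>j\<in>J. a k j * x j) * z j)) = 0"
        unfolding proj[symmetric] p_def kz by simp
      then show "(\<Sum>j\<in>J. p c j * x j) \<le> 0"
        unfolding proj using x[unfolded proj] by (intro insert.prems) auto
    qed
    then obtain y where y: "\<And>i. i \<in> I \<Longrightarrow> 0 \<le> y i"
      "\<And>j. j \<in> J \<Longrightarrow> p c j = (\<Sum>i\<in>I. y i * p (a i) j)"
      by blast
    \<comment> \<open>This is the coefficient that row \<open>k\<close> receives when
      \<open>p\<close> is expanded in the identity for \<open>p c\<close>. It is nonnegative since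
      \<open>c\<close> is positive at \<open>z\<close> while the rows in \<open>I\<close> are
      nonpositive there.\<close>
    define s where "s = (\<Sum>j\<in>J. c j * z j) - (\<Sum>i\<in>I. y i * (\<Sum>j\<in>J. a i j * z j))"
    have "(\<Sum>i\<in>I. y i * (\<Sum>j\<in>J. a i j * z j)) \<le> 0"
      using y(1) iz by (intro sum_nonpos) (simp add: mult_nonneg_nonpos)
    then have s: "0 \<le> s"
      using cz by (simp add: s_def)
    have "c j = (\<Sum>i\<in>insert k I. (y(k := s)) i * a i j)" if "j \<in> J" for j
    proof -
      have "c j = (\<Sum>j\<in>J. c j * z j) * a k j + (\<Sum>i\<in>I. y i * p (a i) j)"
        using y(2)[OF that] by (simp add: p_def)
      also have "(\<Sum>i\<in>I. y i * p (a i) j)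
          = (\<Sum>i\<in>I. y i * a i j) - (\<Sum>i\<in>I. y i * (\<Sum>j\<in>J. a i j * z j)) * a k j"
        unfolding p_def by (simp add: right_diff_distrib sum_subtractf sum_distrib_right mult.assoc)
      also have "(\<Sum>j\<in>J. c j * z j) * a k j + \<dots> = s * a k j + (\<Sum>i\<in>I. y i * a i j)"
        by (simp add: s_def algebra_simps)
      also have "(\<Sum>i\<in>I. y i * a i j) = (\<Sum>i\<in>I. (y(k := s)) i * a i j)"
        using insert.hyps by (intro sum.cong) auto
      finally show ?thesis
        using insert.hyps by simp
    qed
    with y(1) s show ?thesis
      by (intro exI[of _ "y(k := s)"]) auto
  qed
qed

text \<open>Each sign condition on \<open>x k\<close> becomes an extra row, minus the
  \<open>k\<close>-th unit vector. The multipliers of these rows are slacks, and discarding them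
  turns the equalities of \<open>farkas\<close> into inequalities.\<close>

lemma farkas_nonneg:
  fixes a :: "'i \<Rightarrow> 'j \<Rightarrow> real" and c :: "'j \<Rightarrow> real"
  assumes "finite I" "finite J"
    and imp: "\<And>x. (\<And>j. j \<in> J \<Longrightarrow> 0 \<le> x j) \<Longrightarrow> (\<And>i. i \<in> I \<Longrightarrow> (\<Sum>j\<in>J. a i j * x j) \<le> 0)
      \<Longrightarrow> (\<Sum>j\<in>J. c j * x j) \<le> 0"
  shows "\<exists>y. (\<forall>i\<in>I. 0 \<le> y i) \<and> (\<forall>j\<in>J. c j \<le> (\<Sum>i\<in>I. y i * a i j))"
proof -
  define a' where "a' = case_sum a (\<lambda>k j. if j = k then - 1 else 0)"
  have sgn: "(\<Sum>j\<in>J. a' (Inr k) j * x j) = - x k" if "k \<in> J" for k x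
    using assms(2) that by (simp add: a'_def if_distrib[of "\<lambda>u. u * _"] cong: if_cong)
  have "\<exists>y. (\<forall>i\<in>I <+> J. 0 \<le> y i) \<and> (\<forall>j\<in>J. c j = (\<Sum>i\<in>I <+> J. y i * a' i j))"
  proof (rule farkas)
    fix x assume x: "\<And>i. i \<in> I <+> J \<Longrightarrow> (\<Sum>j\<in>J. a' i j * x j) \<le> 0"
    show "(\<Sum>j\<in>J. c j * x j) \<le> 0"
    proof (rule imp)
      show "0 \<le> x j" if "j \<in> J" for j
        using x[of "Inr j"] sgn[OF that] that by auto
      show "(\<Sum>j\<in>J. a i j * x j) \<le> 0" if "i \<in> I" for i
        using x[of "Inl i"] that by (simp add: a'_def InlI)
    qed
  qed (use assms in auto)
  then obtain y where y: "\<forall>i\<in>I <+> J. 0 \<le> y i"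
    "\<forall>j\<in>J. c j = (\<Sum>i\<in>I <+> J. y i * a' i j)"
    by iprover
  have "c j \<le> (\<Sum>i\<in>I. y (Inl i) * a i j)" if "j \<in> J" for j
  proof -
    have "c j = (\<Sum>i\<in>I. y (Inl i) * a' (Inl i) j) + (\<Sum>k\<in>J. y (Inr k) * a' (Inr k) j)"
      using bspec[OF y(2) that] assms(1,2) by (simp add: sum.Plus)
    also have "(\<Sum>k\<in>J. y (Inr k) * a' (Inr k) j) = - y (Inr j)"
      using assms(2) that by (simp add: a'_def if_distrib[of "\<lambda>u. _ * u"] cong: if_cong)
    finally show ?thesis
      using bspec[OF y(1) InrI[OF that]] by (simp add: a'_def)
  qed
  then show ?thesis
    using y(1) by (intro exI[of _ "\<lambda>i. y (Inl i)"]) (auto simp: InlI)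
qed

section \<open>Attainment of the optima\<close>

lemma continuous_on_linear_form:
  fixes f :: "'j \<Rightarrow> real"
  shows "continuous_on S (\<lambda>x. \<Sum>j\<in>J. f j * x j)"
  by (intro continuous_intros continuous_on_subset[OF continuous_on_product_coordinates]) simp

lemma closed_linear_form_le:
  fixes f :: "'j \<Rightarrow> real"
  shows "closed {x. (\<Sum>j\<in>J. f j * x j) \<le> b}"
  by (intro closed_Collect_le continuous_on_linear_form continuous_on_const)

text \<open>All coefficients are nonnegative, so any one constraint using good \<open>j\<close> with
  positive coefficient already bounds \<open>x j\<close>. The set is thus a closed part of a product
  of compact sets. Coordinates outside \<open>J\<close> are pinned to 0 because the ambient space
  consists of total functions.\<close>

lemma compact_plans:
  fixes A :: "'i \<Rightarrow> 'j \<Rightarrow> real" and b :: "'i \<Rightarrow> real"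
  assumes "finite J"
    and nonneg: "\<And>t j. t \<in> Q \<Longrightarrow> j \<in> J \<Longrightarrow> 0 \<le> A t j"
    and pos: "\<And>j. j \<in> J \<Longrightarrow> \<exists>t\<in>Q. 0 < A t j"
  shows "compact {x. (\<forall>t\<in>Q. (\<Sum>j\<in>J. A t j * x j) \<le> b t) \<and> (\<forall>j\<in>J. 0 \<le> x j) \<and> (\<forall>j. j \<notin> J \<longrightarrow> x j = 0)}"
    (is "compact ?K")
proof -
  obtain \<tau> where \<tau>: "\<And>j. j \<in> J \<Longrightarrow> \<tau> j \<in> Q" "\<And>j. j \<in> J \<Longrightarrow> 0 < A (\<tau> j) j"
    using pos by metis
  define C where "C = (\<lambda>j. if j \<in> J then {0 .. b (\<tau> j) / A (\<tau> j) j} else {0})"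
  \<comment> \<open>Tychonoff's theorem for the box of intervals.\<close>
  have "compactin (product_topology (\<lambda>_. euclidean) UNIV) (PiE UNIV C)"
    unfolding compactin_PiE by (auto simp: C_def)
  then have "compact (PiE UNIV C)"
    by (simp add: euclidean_product_topology)
  moreover have "closed (\<Inter>t\<in>Q. {x. (\<Sum>j\<in>J. A t j * x j) \<le> b t})"
    by (intro closed_INT ballI closed_linear_form_le)
  moreover have "x j \<le> b (\<tau> j) / A (\<tau> j) j" if "x \<in> ?K" "j \<in> J" for x j
  proof -
    have "A (\<tau> j) j * x j \<le> (\<Sum>j'\<in>J. A (\<tau> j) j' * x j')"
      using that assms(1) \<tau> nonneg by (intro member_le_sum) auto
    also have "\<dots> \<le> b (\<tau> j)"
      using that \<tau> by auto
    finally show ?thesis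
      using \<tau>(2)[OF that(2)] by (simp add: field_simps)
  qed
  then have "?K = PiE UNIV C \<inter> (\<Inter>t\<in>Q. {x. (\<Sum>j\<in>J. A t j * x j) \<le> b t})"
    by (auto simp: C_def PiE_iff split: if_splits)
  ultimately show ?thesis
    by (simp only: compact_Int_closed)
qed

section \<open>Linear production situations\<close>

locale lpp_model =
  fixes L :: lpp
  assumes situation: "lpp_situation L"
begin

section \<open>Production plans and their profit\<close>

definition usage :: "(nat \<Rightarrow> real) \<Rightarrow> real" where
  "usage x = (\<Sum>j\<in>goods L. tech L (num_resources L + 1) j * x j)"

definition revenue :: "(nat \<Rightarrow> real) \<Rightarrow> real" where
  "revenue x = (\<Sum>j\<in>goods L. price L j * x j)"

definition net_price :: "nat \<Rightarrow> real" where
  "net_price j = price L j - unit_cost L * tech L (num_resources L + 1) j"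

definition net_revenue :: "(nat \<Rightarrow> real) \<Rightarrow> real" where
  "net_revenue x = (\<Sum>j\<in>goods L. net_price j * x j)"

text \<open>The pool constraint is left out, since pool usage is charged through
  \<open>net_price\<close>. Vanishing outside the goods makes the set compact.\<close>

definition plans :: "nat set \<Rightarrow> (nat \<Rightarrow> real) set" where
  "plans S = {x. (\<forall>t\<in>resources L. (\<Sum>j\<in>goods L. tech L t j * x j) \<le> coalition_endow L S t)
     \<and> (\<forall>j\<in>goods L. 0 \<le> x j) \<and> (\<forall>j. j \<notin> goods L \<longrightarrow> x j = 0)}"

lemma net_revenue_eq: "net_revenue x = revenue x - unit_cost L * usage x"
  by (simp add: net_revenue_def revenue_def usage_def net_price_def left_diff_distrib
      sum_subtractf sum_distrib_left mult.assoc)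

lemma finite_goods: "finite (goods L)" and finite_resources: "finite (resources L)"
  and finite_producers: "finite (producers L)"
  by (auto simp: goods_def resources_def producers_def)

lemma tech_nonneg: "t \<in> resources L \<Longrightarrow> j \<in> goods L \<Longrightarrow> 0 \<le> tech L t j"
  and pool_tech_nonneg: "j \<in> goods L \<Longrightarrow> 0 \<le> tech L (num_resources L + 1) j"
  and tech_pos: "j \<in> goods L \<Longrightarrow> \<exists>t\<in>resources L. 0 < tech L t j"
  and unit_cost_nonneg: "0 \<le> unit_cost L"
  using situation by (auto simp: lpp_situation_def resources_def)

lemma coalition_endow_nonneg:
  "S \<subseteq> producers L \<Longrightarrow> t \<in> resources L \<Longrightarrow> 0 \<le> coalition_endow L S t"
  using situation by (auto simp: lpp_situation_def coalition_endow_def intro!: sum_nonneg)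

lemma compact_plans_coalition: "compact (plans S)"
  unfolding plans_def using finite_goods tech_nonneg tech_pos by (intro compact_plans) auto

lemma zero_plan: "S \<subseteq> producers L \<Longrightarrow> (\<lambda>_. 0) \<in> plans S"
  using coalition_endow_nonneg by (simp add: plans_def)

lemma usage_nonneg: "x \<in> plans S \<Longrightarrow> 0 \<le> usage x"
  unfolding usage_def plans_def using pool_tech_nonneg by (intro sum_nonneg) auto

lemma feasible_plan: "x \<in> plans S \<Longrightarrow> usage x \<le> z \<Longrightarrow> feasible L S z x"
  by (simp add: feasible_def plans_def usage_def)

text \<open>Zeroing the coordinates that are not goods changes no sum over goods, so every feasible
  plan has an equivalent one in the compact set \<open>plans S\<close>.\<close>

lemma feasibleE:
  assumes "feasible L S z x"
  obtains x' where "x' \<in> plans S" "usage x' \<le> z" "revenue x' = revenue x"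
proof
  let ?x = "\<lambda>j. if j \<in> goods L then x j else 0"
  have eq: "(\<Sum>j\<in>goods L. f j * ?x j) = (\<Sum>j\<in>goods L. f j * x j)" for f
    by (intro sum.cong) auto
  show "?x \<in> plans S" "usage ?x \<le> z" "revenue ?x = revenue x"
    using assms by (auto simp: plans_def usage_def revenue_def feasible_def eq)
qed

section \<open>Attained values and optimal demand\<close>

lemma coalition_value_attained:
  assumes "S \<subseteq> producers L" "0 \<le> z"
  obtains x where "x \<in> plans S" "usage x \<le> z" "coalition_value L S z = revenue x - unit_cost L * z"
    "\<And>x'. x' \<in> plans S \<Longrightarrow> usage x' \<le> z \<Longrightarrow> revenue x' \<le> revenue x"
proof -
  let ?K = "plans S \<inter> {x. usage x \<le> z}"
  have "compact ?K"
    unfolding usage_def by (intro compact_Int_closed compact_plans_coalition closed_linear_form_le)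
  moreover have "(\<lambda>_. 0) \<in> ?K"
    using zero_plan[OF assms(1)] assms(2) by (simp add: usage_def)
  moreover have "continuous_on ?K revenue"
    unfolding revenue_def by (rule continuous_on_linear_form)
  ultimately obtain x where x: "x \<in> ?K" "\<forall>x'\<in>?K. revenue x' \<le> revenue x"
    using continuous_attains_sup[of ?K revenue] by blast
  have "coalition_value L S z = revenue x - unit_cost L * z"
    unfolding coalition_value_def
  proof (rule Greatest_equality)
    show "\<exists>x'. feasible L S z x' \<and> revenue x - unit_cost L * z
        = (\<Sum>j\<in>goods L. price L j * x' j) - unit_cost L * z"
      using x(1) by (auto intro!: exI[of _ x] feasible_plan simp: revenue_def)
    fix v assume "\<exists>x. feasible L S z x \<and> v = (\<Sum>j\<in>goods L. price L j * x j) - unit_cost L * z"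
    then obtain x' where "feasible L S z x'" "v = revenue x' - unit_cost L * z"
      by (auto simp: revenue_def)
    then show "v \<le> revenue x - unit_cost L * z"
      using x(2) by (elim feasibleE) (metis IntI diff_right_mono mem_Collect_eq)
  qed
  with x show ?thesis
    by (intro that) auto
qed

text \<open>Buying \<open>z\<close> costs at least as much as buying the amount used, so charging
  actual usage instead can only raise the profit of a feasible plan.\<close>

lemma coalition_value_le:
  assumes "S \<subseteq> producers L" "0 \<le> z" "\<And>x. x \<in> plans S \<Longrightarrow> net_revenue x \<le> V"
  shows "coalition_value L S z \<le> V"
proof -
  obtain x where x: "x \<in> plans S" "usage x \<le> z" "coalition_value L S z = revenue x - unit_cost L * z"
    using coalition_value_attained[OF assms(1,2)] by metis
  have "coalition_value L S z \<le> net_revenue x"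
    using x unit_cost_nonneg by (simp add: net_revenue_eq mult_left_mono)
  also have "\<dots> \<le> V"
    using assms(3) x(1) by blast
  finally show ?thesis .
qed

lemma net_revenue_le_value:
  assumes "S \<subseteq> producers L" "x \<in> plans S"
  shows "net_revenue x \<le> coalition_value L S (usage x)"
proof -
  obtain x' where "coalition_value L S (usage x) = revenue x' - unit_cost L * usage x"
    "revenue x \<le> revenue x'"
    using coalition_value_attained[OF assms(1) usage_nonneg[OF assms(2)]] assms(2)
    by (metis order_refl)
  then show ?thesis
    by (simp add: net_revenue_eq)
qed

text \<open>The least optimal pool amount is the least usage among the plans of maximal net revenue.\<close>

lemma optimal_demand:
  assumes S: "S \<subseteq> producers L"
  shows "0 \<le> optimal_demand L S"
    and "0 \<le> z \<Longrightarrow> coalition_value L S z \<le> coalition_value L S (optimal_demand L S)"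
proof -
  have "continuous_on (plans S) net_revenue"
    unfolding net_revenue_def by (rule continuous_on_linear_form)
  then obtain x0 where x0: "x0 \<in> plans S" "\<And>x. x \<in> plans S \<Longrightarrow> net_revenue x \<le> net_revenue x0"
    using continuous_attains_sup[OF compact_plans_coalition, of S net_revenue] zero_plan[OF S] by blast
  \<comment> \<open>The compact set of maximisers of net revenue; usage attains its minimum on
    it.\<close>
  let ?K = "plans S \<inter> {x. net_revenue x \<ge> net_revenue x0}"
  have "compact ?K"
    unfolding net_revenue_def
    by (intro compact_Int_closed compact_plans_coalition closed_Collect_le continuous_on_const
        continuous_on_linear_form)
  moreover have "continuous_on ?K usage"
    unfolding usage_def by (rule continuous_on_linear_form)
  ultimately obtain x where x: "x \<in> ?K" "\<And>x'. x' \<in> ?K \<Longrightarrow> usage x \<le> usage x'"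
    using continuous_attains_inf[of ?K usage] x0(1) by blast
  have V: "coalition_value L S z \<le> net_revenue x0" if "0 \<le> z" for z
    using coalition_value_le[OF S that] x0(2) by blast
  have Vx: "net_revenue x0 \<le> coalition_value L S (usage x)"
    using net_revenue_le_value[OF S, of x] x(1) by auto
  have "optimal_demand L S = usage x"
    unfolding optimal_demand_def
  proof (rule Least_equality)
    show "0 \<le> usage x \<and> (\<forall>z'\<ge>0. coalition_value L S z' \<le> coalition_value L S (usage x))"
      using x(1) usage_nonneg V Vx by fastforce
    fix z assume z: "0 \<le> z \<and> (\<forall>z'\<ge>0. coalition_value L S z' \<le> coalition_value L S z)"
    then obtain x' where x': "x' \<in> plans S" "usage x' \<le> z"
      "coalition_value L S z = revenue x' - unit_cost L * z"
      using coalition_value_attained[OF S] by metis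
    \<comment> \<open>A plan \<open>x'\<close> attaining the value at an optimal \<open>z\<close>
      must itself maximise net revenue, so its usage, which is at most \<open>z\<close>, is at least
      the minimal one.\<close>
    have "net_revenue x0 \<le> coalition_value L S z"
      using Vx z x(1) usage_nonneg by fastforce
    also have "\<dots> \<le> net_revenue x'"
      using x' unit_cost_nonneg by (simp add: net_revenue_eq mult_left_mono)
    finally show "usage x \<le> z"
      using x(2)[of x'] x' by auto
  qed
  then show "0 \<le> optimal_demand L S"
    and "0 \<le> z \<Longrightarrow> coalition_value L S z \<le> coalition_value L S (optimal_demand L S)"
    using x(1) usage_nonneg V[of z] Vx by auto
qed

lemma net_revenue_le_optimum:
  assumes "S \<subseteq> producers L" "x \<in> plans S"
  shows "net_revenue x \<le> coalition_value L S (optimal_demand L S)"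
  using net_revenue_le_value[OF assms] optimal_demand(2)[OF assms(1) usage_nonneg[OF assms(2)]]
  by linarith

section \<open>Linear programming duality\<close>

text \<open>Homogenising with the extra variable \<open>x 0\<close> (0 is not a good) makes Farkas' lemma applicable.\<close>

lemma dual_prices:
  assumes V: "\<And>x. x \<in> plans S \<Longrightarrow> net_revenue x \<le> V"
  obtains y where "\<And>t. t \<in> resources L \<Longrightarrow> 0 \<le> y t"
    "\<And>j. j \<in> goods L \<Longrightarrow> net_price j \<le> (\<Sum>t\<in>resources L. y t * tech L t j)"
    "(\<Sum>t\<in>resources L. y t * coalition_endow L S t) \<le> V"
proof -
  have 0: "0 \<notin> goods L"
    by (simp add: goods_def)
  define a where "a t j = (if j = 0 then - coalition_endow L S t else tech L t j)" for t j :: nat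
  define c where "c j = (if j = 0 then - V else net_price j)" for j :: nat
  have sum_a: "(\<Sum>j\<in>insert 0 (goods L). a t j * x j)
      = (\<Sum>j\<in>goods L. tech L t j * x j) - coalition_endow L S t * x 0" for t x
    using 0 finite_goods by (simp add: a_def) (intro sum.cong; auto)
  have sum_c: "(\<Sum>j\<in>insert 0 (goods L). c j * x j) = net_revenue x - V * x 0" for x
    using 0 finite_goods by (simp add: c_def net_revenue_def) (intro sum.cong; auto)
  have "\<exists>y. (\<forall>t\<in>resources L. 0 \<le> y t)
      \<and> (\<forall>j\<in>insert 0 (goods L). c j \<le> (\<Sum>t\<in>resources L. y t * a t j))"
  proof (rule farkas_nonneg)
    fix x :: "nat \<Rightarrow> real"
    assume x: "\<And>j. j \<in> insert 0 (goods L) \<Longrightarrow> 0 \<le> x j"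
      and "\<And>t. t \<in> resources L \<Longrightarrow> (\<Sum>j\<in>insert 0 (goods L). a t j * x j) \<le> 0"
    then have Ax: "(\<Sum>j\<in>goods L. tech L t j * x j) \<le> coalition_endow L S t * x 0"
      if "t \<in> resources L" for t
      using that by (simp add: sum_a)
    show "(\<Sum>j\<in>insert 0 (goods L). c j * x j) \<le> 0"
    \<comment> \<open>For \<open>x 0 = 0\<close> the point is a recession direction of the plans,
      which is zero because every good consumes an owned resource. For positive \<open>x 0\<close>,
      dividing by it gives a genuine plan, to which the bound \<open>V\<close> applies.\<close>
    proof (cases "x 0 = 0")
      case True
      have "x j = 0" if j: "j \<in> goods L" for j
      proof -
        obtain t where t: "t \<in> resources L" "0 < tech L t j"
          using tech_pos[OF j] by blast
        have "tech L t j * x j \<le> (\<Sum>j\<in>goods L. tech L t j * x j)"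
          using j t(1) x finite_goods tech_nonneg by (intro member_le_sum) auto
        with Ax[OF t(1)] True t(2) have "tech L t j * x j \<le> 0"
          by simp
        with t(2) have "x j \<le> 0"
          by (simp add: mult_le_0_iff)
        with x j show ?thesis
          by (simp add: antisym)
      qed
      then show ?thesis
        unfolding sum_c by (simp add: True net_revenue_def)
    next
      case False
      then have x0: "0 < x 0"
        using x[of 0] by simp
      define x' where "x' j = (if j \<in> goods L then x j / x 0 else 0)" for j
      have scale: "(\<Sum>j\<in>goods L. f j * x' j) = (\<Sum>j\<in>goods L. f j * x j) / x 0" for f
        unfolding sum_divide_distrib by (intro sum.cong) (auto simp: x'_def)
      have "x' \<in> plans S"
        using x0 x Ax by (auto simp: plans_def scale pos_divide_le_eq) (simp add: x'_def)+
      then have "net_revenue x / x 0 \<le> V"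
        using V by (simp add: net_revenue_def flip: scale)
      then show ?thesis
        using x0 by (simp add: sum_c pos_divide_le_eq)
    qed
  qed (use finite_goods finite_resources in auto)
  then obtain y where y: "\<And>t. t \<in> resources L \<Longrightarrow> 0 \<le> y t"
    "\<And>j. j \<in> insert 0 (goods L) \<Longrightarrow> c j \<le> (\<Sum>t\<in>resources L. y t * a t j)"
    by blast
  show ?thesis
  proof
    show "net_price j \<le> (\<Sum>t\<in>resources L. y t * tech L t j)" if "j \<in> goods L" for j
      using y(2)[of j] 0 that by (cases "j = 0") (auto simp: a_def c_def)
    \<comment> \<open>This is the dual inequality of the homogenising coordinate 0, with both signs
      reversed.\<close>
    show "(\<Sum>t\<in>resources L. y t * coalition_endow L S t) \<le> V"
      using y(2)[of 0] by (simp add: a_def c_def sum_negf)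
  qed (rule y(1))
qed

text \<open>Weak duality. The conditions on \<open>y\<close> do not mention endowments, so prices
  found for the grand coalition bound the profit of every coalition.\<close>

lemma net_revenue_le_dual:
  assumes y: "\<And>t. t \<in> resources L \<Longrightarrow> 0 \<le> y t"
    "\<And>j. j \<in> goods L \<Longrightarrow> net_price j \<le> (\<Sum>t\<in>resources L. y t * tech L t j)"
    and x: "x \<in> plans S"
  shows "net_revenue x \<le> (\<Sum>t\<in>resources L. y t * coalition_endow L S t)"
proof -
  have "net_revenue x \<le> (\<Sum>j\<in>goods L. (\<Sum>t\<in>resources L. y t * tech L t j) * x j)"
    unfolding net_revenue_def using x y(2)
    by (intro sum_mono mult_right_mono) (auto simp: plans_def)
  also have "\<dots> = (\<Sum>t\<in>resources L. y t * (\<Sum>j\<in>goods L. tech L t j * x j))"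
    unfolding sum_distrib_left sum_distrib_right by (subst sum.swap) (simp add: mult.assoc)
  also have "\<dots> \<le> (\<Sum>t\<in>resources L. y t * coalition_endow L S t)"
    using x y(1) by (intro sum_mono mult_left_mono) (auto simp: plans_def)
  finally show ?thesis .
qed

section \<open>Minimal partitions and the pool bound\<close>

lemma partition_demand_le_pool:
  assumes M: "M_min L = {}" and P: "partition_on (producers L) P"
  shows "partition_demand L P \<le> pool L"
proof (rule ccontr)
  \<comment> \<open>Refinement is a partial order on the finitely many partitions. If some partition
    had demand above the pool, a minimal one would exist and belong to
    \<open>M_min L\<close>.\<close>
  let ?X = "{P. partition_on (producers L) P \<and> pool L < partition_demand L P}"
  let ?R = "\<lambda>P' P. refines (producers L) P' P \<and> P' \<noteq> P"
  assume "\<not> partition_demand L P \<le> pool L"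
  then have "?X \<noteq> {}"
    using P by auto
  moreover have "finite ?X"
    using finitely_many_partition_on[OF finite_producers] by (rule finite_subset[rotated]) auto
  moreover have "asymp_on ?X ?R" "transp_on ?X ?R"
    by (auto intro!: asymp_onI transp_onI dest: refines_asym intro: refines_trans)
  ultimately obtain Q where Q: "Q \<in> ?X" "\<forall>P\<in>?X. P \<noteq> Q \<longrightarrow> \<not> ?R P Q"
    using Finite_Set.bex_min_element[of ?X ?R] by auto
  then have "Q \<in> M_min L"
    by (auto simp: M_min_def refines_def)
  with M show False
    by simp
qed

end

section \<open>Dual prices as a core allocation\<close>

theorem theorem8:
  fixes L :: lpp
  assumes "lpp_situation L"
    and "M_min L = {}"
  shows "core (producers L) (lpp_game L) \<noteq> {}"
proof -
  interpret lpp_model L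
    by unfold_locales (rule assms)
  let ?N = "producers L" and ?Q = "resources L"
  let ?V = "coalition_value L ?N (optimal_demand L ?N)"
  have N: "?N \<noteq> {}"
    using assms(1) by (simp add: lpp_situation_def producers_def)
  \<comment> \<open>The one-block partition has total demand \<open>optimal_demand L ?N\<close>, so
    the minimum in the grand coalition's value is its own optimal demand.\<close>
  have "optimal_demand L ?N \<le> pool L"
    using partition_demand_le_pool[OF assms(2) partition_on_space[OF N]]
    by (simp add: partition_demand_def)
  then have game: "lpp_game L S = coalition_value L S (optimal_demand L S)" if "S \<noteq> {}" for S
    using that by (auto simp: lpp_game_def min_def)
  obtain y where y: "\<And>t. t \<in> ?Q \<Longrightarrow> 0 \<le> y t"
    "\<And>j. j \<in> goods L \<Longrightarrow> net_price j \<le> (\<Sum>t\<in>?Q. y t * tech L t j)"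
    and yV: "(\<Sum>t\<in>?Q. y t * coalition_endow L ?N t) \<le> ?V"
    using dual_prices[of ?N ?V] net_revenue_le_optimum by blast
  \<comment> \<open>Each producer is paid the worth of the owned resources at the dual prices. The
    restricted lambda is needed because \<open>core\<close> consists of extensional
    functions.\<close>
  define x where "x = (\<lambda>i\<in>?N. \<Sum>t\<in>?Q. y t * endow L t i)"
  have sum_x: "(\<Sum>i\<in>S. x i) = (\<Sum>t\<in>?Q. y t * coalition_endow L S t)" if "S \<subseteq> ?N" for S
  proof -
    have "(\<Sum>i\<in>S. x i) = (\<Sum>i\<in>S. \<Sum>t\<in>?Q. y t * endow L t i)"
      using that by (intro sum.cong) (auto simp: x_def)
    then show ?thesis
      by (subst (asm) sum.swap) (simp add: coalition_endow_def sum_distrib_left)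
  qed
  have stable: "lpp_game L S \<le> (\<Sum>i\<in>S. x i)" if S: "S \<subseteq> ?N" for S
  proof (cases "S = {}")
    case False
    show ?thesis
      unfolding game[OF False] sum_x[OF S]
      using S optimal_demand(1)[OF S] net_revenue_le_dual[OF y]
      by (intro coalition_value_le) auto
  qed (simp add: lpp_game_def)
  \<comment> \<open>Stability for the grand coalition gives one inequality, and the dual bound
    \<open>yV\<close> the other.\<close>
  have "(\<Sum>i\<in>?N. x i) = lpp_game L ?N"
    using stable[of ?N] yV by (simp add: sum_x game[OF N])
  with stable have "x \<in> core ?N (lpp_game L)"
    by (auto simp: core_def x_def)
  then show ?thesis
    by blast
qed

end
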